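(* For $i,j\in\{1,2,\dots,35\}$ with $i\neq j$, no algebra of type $\mathbf{A}i$ is isomorphic to an algebra of type $\mathbf{A}j$, where the types $\mathbf{A1},\dots,\mathbf{A35}$ of real 3-dimensional commutative algebras are those listed in the context.
   Context: All algebras are real 3-dimensional commutative (not necessarily associative) algebras with basis $(e_1,e_2,e_3)$; products of basis vectors not listed (up to commutativity) are $0$; parameters are real. $A_1(\alpha,\beta)$: $e_3^2=e_3,\ e_1e_2=e_3,\ e_1e_3=\alpha e_1,\ e_2e_3=\beta e_2$. $A_2(\alpha,\beta)$: $e_3^2=e_3,\ e_1e_3=\alpha e_1,\ e_2e_3=\beta e_2$. $A_3(\alpha,\beta)$: $e_1e_2=e_3,\ e_1e_3=\alpha e_1,\ e_2e_3=\beta e_2$. $A_4(\alpha,\beta)$: $e_1e_3=\alpha e_1,\ e_2e_3=\beta e_2$. $A_{22}$: $e_3^2=e_3,\ e_2e_3=e_1$. $A_5(a,b)$: $e_3^2=e_3,\ e_1e_3=ae_1-be_2,\ e_2e_3=be_1+ae_2$. $A_6(\alpha,\beta)$: $e_2^2=e_1,\ e_3^2=e_3,\ e_1e_3=\alpha e_1,\ e_2e_3=\beta e_2$. $A_7(\alpha,\beta)$: $e_1^2=e_2,\ e_1e_3=\alpha e_1,\ e_2e_3=\beta e_2$. Types: A1: $A_1(0,0)$. A2: $A_1(0,\frac12)$. A3: $A_1(\frac12,\frac12)$. A4: $A_1(\alpha,0)$, $\alpha\notin\{0,\frac12\}$. A5: $A_1(\alpha,\frac12)$, $\alpha\notin\{0,\frac12\}$.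 A6: $A_1(\alpha,\alpha)$, $\alpha\notin\{0,\frac12\}$. A7: $A_1(\alpha,\beta)$, $\alpha<\beta$, $\alpha,\beta\notin\{0,\frac12\}$. A8: $A_2(0,0)$. A9: $A_2(0,\frac12)$. A10: $A_2(\frac12,\frac12)$. A11: $A_2(0,\beta)$, $\beta\notin\{0,\frac12\}$. A12: $A_2(\frac12,\beta)$, $\beta\notin\{0,\frac12\}$. A13: $A_2(\alpha,\alpha)$, $\alpha\notin\{0,\frac12\}$. A14: $A_2(\alpha,\beta)$, $\alpha<\beta$, $\alpha,\beta\notin\{0,\frac12\}$. A15: $A_3(0,0)$. A16: $A_3(0,1)$. A17: $A_3(1,1)$. A18: $A_3(1,\beta)$, $\beta>1$. A19: $A_4(0,1)$. A20: $A_4(1,1)$. A21: $A_4(1,\beta)$, $\beta\notin\{0,1\}$. A22: $A_{22}$. A23: $A_5(a,b)$, $b>0$. A24: $A_6(0,\beta)$, $\beta\notin\{0,\frac12\}$. A25: $A_6(0,0)$. A26: $A_6(0,\frac12)$. A27: $A_6(\alpha,\beta)$, $\alpha,\beta\notin\{0,\frac12\}$, $\alpha\ne\beta$. A28: $A_6(\alpha,\alpha)$, $\alpha\notin\{0,\frac12\}$. A29: $A_6(\alpha,\frac12)$, $\alpha\notin\{0,\frac12\}$. A30: $A_6(\frac12,\frac12)$. A31: $A_6(\frac12,\beta)$, $\beta\notin\{0,\frac12\}$. A32: $A_7(0,0)$. A33: $A_7(1,\beta)$, $\beta\notin\{0,1\}$. A34: $A_7(1,1)$. A35: $A_7(1,0)$.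 *)

theory Defs
  imports "HOL-Analysis.Analysis"
begin

text \<open>
  An algebra is given by its product \<open>m\<close> on a real vector space, which is the whole type.
  Neither associativity nor a unit is assumed.
\<close>

definition comm_algebra :: "('a::real_vector \<Rightarrow> 'a \<Rightarrow> 'a) \<Rightarrow> bool" where
  "comm_algebra m \<longleftrightarrow> bilinear m \<and> (\<forall>x y. m x y = m y x)"

definition basis3 :: "'a::real_vector \<Rightarrow> 'a \<Rightarrow> 'a \<Rightarrow> bool" where
  "basis3 e1 e2 e3 \<longleftrightarrow>
     distinct [e1, e2, e3] \<and> independent {e1, e2, e3} \<and> span {e1, e2, e3} = UNIV"

definition alg_isomorphic ::
    "('a::real_vector \<Rightarrow> 'a \<Rightarrow> 'a) \<Rightarrow> ('b::real_vector \<Rightarrow> 'b \<Rightarrow> 'b) \<Rightarrow> bool" where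
  "alg_isomorphic m n \<longleftrightarrow>
     (\<exists>\<phi>. linear \<phi> \<and> bij \<phi> \<and> (\<forall>x y. \<phi> (m x y) = n (\<phi> x) (\<phi> y)))"

text \<open>
  \<open>alg_Ak\<close> holds of \<open>m\<close> if \<open>m\<close> has the multiplication table of the algebra $A_k$ in some
  basis \<open>(e1, e2, e3)\<close>. The products omitted from the usual description are
  spelled out as zero; those with the factors swapped follow from commutativity.
\<close>

definition alg_A1 :: "real \<Rightarrow> real \<Rightarrow> ('a::real_vector \<Rightarrow> 'a \<Rightarrow> 'a) \<Rightarrow> bool" where
  "alg_A1 \<alpha> \<beta> m \<longleftrightarrow> comm_algebra m \<and> (\<exists>e1 e2 e3. basis3 e1 e2 e3 \<and>
     m e1 e1 = 0 \<and> m e1 e2 = e3 \<and> m e1 e3 = \<alpha> *\<^sub>R e1 \<and>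
     m e2 e2 = 0 \<and> m e2 e3 = \<beta> *\<^sub>R e2 \<and> m e3 e3 = e3)"

definition alg_A2 :: "real \<Rightarrow> real \<Rightarrow> ('a::real_vector \<Rightarrow> 'a \<Rightarrow> 'a) \<Rightarrow> bool" where
  "alg_A2 \<alpha> \<beta> m \<longleftrightarrow> comm_algebra m \<and> (\<exists>e1 e2 e3. basis3 e1 e2 e3 \<and>
     m e1 e1 = 0 \<and> m e1 e2 = 0 \<and> m e1 e3 = \<alpha> *\<^sub>R e1 \<and>
     m e2 e2 = 0 \<and> m e2 e3 = \<beta> *\<^sub>R e2 \<and> m e3 e3 = e3)"

definition alg_A3 :: "real \<Rightarrow> real \<Rightarrow> ('a::real_vector \<Rightarrow> 'a \<Rightarrow> 'a) \<Rightarrow> bool" where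
  "alg_A3 \<alpha> \<beta> m \<longleftrightarrow> comm_algebra m \<and> (\<exists>e1 e2 e3. basis3 e1 e2 e3 \<and>
     m e1 e1 = 0 \<and> m e1 e2 = e3 \<and> m e1 e3 = \<alpha> *\<^sub>R e1 \<and>
     m e2 e2 = 0 \<and> m e2 e3 = \<beta> *\<^sub>R e2 \<and> m e3 e3 = 0)"

definition alg_A4 :: "real \<Rightarrow> real \<Rightarrow> ('a::real_vector \<Rightarrow> 'a \<Rightarrow> 'a) \<Rightarrow> bool" where
  "alg_A4 \<alpha> \<beta> m \<longleftrightarrow> comm_algebra m \<and> (\<exists>e1 e2 e3. basis3 e1 e2 e3 \<and>
     m e1 e1 = 0 \<and> m e1 e2 = 0 \<and> m e1 e3 = \<alpha> *\<^sub>R e1 \<and>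
     m e2 e2 = 0 \<and> m e2 e3 = \<beta> *\<^sub>R e2 \<and> m e3 e3 = 0)"

definition alg_A22 :: "('a::real_vector \<Rightarrow> 'a \<Rightarrow> 'a) \<Rightarrow> bool" where
  "alg_A22 m \<longleftrightarrow> comm_algebra m \<and> (\<exists>e1 e2 e3. basis3 e1 e2 e3 \<and>
     m e1 e1 = 0 \<and> m e1 e2 = 0 \<and> m e1 e3 = 0 \<and>
     m e2 e2 = 0 \<and> m e2 e3 = e1 \<and> m e3 e3 = e3)"

definition alg_A5 :: "real \<Rightarrow> real \<Rightarrow> ('a::real_vector \<Rightarrow> 'a \<Rightarrow> 'a) \<Rightarrow> bool" where
  "alg_A5 a b m \<longleftrightarrow> comm_algebra m \<and> (\<exists>e1 e2 e3. basis3 e1 e2 e3 \<and>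
     m e1 e1 = 0 \<and> m e1 e2 = 0 \<and> m e1 e3 = a *\<^sub>R e1 - b *\<^sub>R e2 \<and>
     m e2 e2 = 0 \<and> m e2 e3 = b *\<^sub>R e1 + a *\<^sub>R e2 \<and> m e3 e3 = e3)"

definition alg_A6 :: "real \<Rightarrow> real \<Rightarrow> ('a::real_vector \<Rightarrow> 'a \<Rightarrow> 'a) \<Rightarrow> bool" where
  "alg_A6 \<alpha> \<beta> m \<longleftrightarrow> comm_algebra m \<and> (\<exists>e1 e2 e3. basis3 e1 e2 e3 \<and>
     m e1 e1 = 0 \<and> m e1 e2 = 0 \<and> m e1 e3 = \<alpha> *\<^sub>R e1 \<and>
     m e2 e2 = e1 \<and> m e2 e3 = \<beta> *\<^sub>R e2 \<and> m e3 e3 = e3)"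

definition alg_A7 :: "real \<Rightarrow> real \<Rightarrow> ('a::real_vector \<Rightarrow> 'a \<Rightarrow> 'a) \<Rightarrow> bool" where
  "alg_A7 \<alpha> \<beta> m \<longleftrightarrow> comm_algebra m \<and> (\<exists>e1 e2 e3. basis3 e1 e2 e3 \<and>
     m e1 e1 = e2 \<and> m e1 e2 = 0 \<and> m e1 e3 = \<alpha> *\<^sub>R e1 \<and>
     m e2 e2 = 0 \<and> m e2 e3 = \<beta> *\<^sub>R e2 \<and> m e3 e3 = 0)"

text \<open>
  \<open>alg_type k m\<close>: the algebra \<open>m\<close> is of type $\mathbf{A}k$. The rules are not recursive, so this
  is just a case distinction on \<open>k\<close>, with the parameters existentially quantified in each case.
\<close>

inductive alg_type :: "nat \<Rightarrow> ('a::real_vector \<Rightarrow> 'a \<Rightarrow> 'a) \<Rightarrow> bool" where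
  A1: "alg_A1 0 0 m \<Longrightarrow> alg_type 1 m"
| A2: "alg_A1 0 (1/2) m \<Longrightarrow> alg_type 2 m"
| A3: "alg_A1 (1/2) (1/2) m \<Longrightarrow> alg_type 3 m"
| A4: "\<alpha> \<notin> {0, 1/2} \<Longrightarrow> alg_A1 \<alpha> 0 m \<Longrightarrow> alg_type 4 m"
| A5: "\<alpha> \<notin> {0, 1/2} \<Longrightarrow> alg_A1 \<alpha> (1/2) m \<Longrightarrow> alg_type 5 m"
| A6: "\<alpha> \<notin> {0, 1/2} \<Longrightarrow> alg_A1 \<alpha> \<alpha> m \<Longrightarrow> alg_type 6 m"
| A7: "\<alpha> < \<beta> \<Longrightarrow> \<alpha> \<notin> {0, 1/2} \<Longrightarrow> \<beta> \<notin> {0, 1/2} \<Longrightarrow> alg_A1 \<alpha> \<beta> m \<Longrightarrow> alg_type 7 m"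
| A8: "alg_A2 0 0 m \<Longrightarrow> alg_type 8 m"
| A9: "alg_A2 0 (1/2) m \<Longrightarrow> alg_type 9 m"
| A10: "alg_A2 (1/2) (1/2) m \<Longrightarrow> alg_type 10 m"
| A11: "\<beta> \<notin> {0, 1/2} \<Longrightarrow> alg_A2 0 \<beta> m \<Longrightarrow> alg_type 11 m"
| A12: "\<beta> \<notin> {0, 1/2} \<Longrightarrow> alg_A2 (1/2) \<beta> m \<Longrightarrow> alg_type 12 m"
| A13: "\<alpha> \<notin> {0, 1/2} \<Longrightarrow> alg_A2 \<alpha> \<alpha> m \<Longrightarrow> alg_type 13 m"
| A14: "\<alpha> < \<beta> \<Longrightarrow> \<alpha> \<notin> {0, 1/2} \<Longrightarrow> \<beta> \<notin> {0, 1/2} \<Longrightarrow> alg_A2 \<alpha> \<beta> m \<Longrightarrow> alg_type 14 m"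
| A15: "alg_A3 0 0 m \<Longrightarrow> alg_type 15 m"
| A16: "alg_A3 0 1 m \<Longrightarrow> alg_type 16 m"
| A17: "alg_A3 1 1 m \<Longrightarrow> alg_type 17 m"
| A18: "\<beta> > 1 \<Longrightarrow> alg_A3 1 \<beta> m \<Longrightarrow> alg_type 18 m"
| A19: "alg_A4 0 1 m \<Longrightarrow> alg_type 19 m"
| A20: "alg_A4 1 1 m \<Longrightarrow> alg_type 20 m"
| A21: "\<beta> \<notin> {0, 1} \<Longrightarrow> alg_A4 1 \<beta> m \<Longrightarrow> alg_type 21 m"
| A22: "alg_A22 m \<Longrightarrow> alg_type 22 m"
| A23: "b > 0 \<Longrightarrow> alg_A5 a b m \<Longrightarrow> alg_type 23 m"
| A24: "\<beta> \<notin> {0, 1/2} \<Longrightarrow> alg_A6 0 \<beta> m \<Longrightarrow> alg_type 24 m"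
| A25: "alg_A6 0 0 m \<Longrightarrow> alg_type 25 m"
| A26: "alg_A6 0 (1/2) m \<Longrightarrow> alg_type 26 m"
| A27: "\<alpha> \<notin> {0, 1/2} \<Longrightarrow> \<beta> \<notin> {0, 1/2} \<Longrightarrow> \<alpha> \<noteq> \<beta> \<Longrightarrow> alg_A6 \<alpha> \<beta> m \<Longrightarrow> alg_type 27 m"
| A28: "\<alpha> \<notin> {0, 1/2} \<Longrightarrow> alg_A6 \<alpha> \<alpha> m \<Longrightarrow> alg_type 28 m"
| A29: "\<alpha> \<notin> {0, 1/2} \<Longrightarrow> alg_A6 \<alpha> (1/2) m \<Longrightarrow> alg_type 29 m"
| A30: "alg_A6 (1/2) (1/2) m \<Longrightarrow> alg_type 30 m"
| A31: "\<beta> \<notin> {0, 1/2} \<Longrightarrow> alg_A6 (1/2) \<beta> m \<Longrightarrow> alg_type 31 m"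
| A32: "alg_A7 0 0 m \<Longrightarrow> alg_type 32 m"
| A33: "\<beta> \<notin> {0, 1} \<Longrightarrow> alg_A7 1 \<beta> m \<Longrightarrow> alg_type 33 m"
| A34: "alg_A7 1 1 m \<Longrightarrow> alg_type 34 m"
| A35: "alg_A7 1 0 m \<Longrightarrow> alg_type 35 m"

text \<open>
  Every multiplication table is realised on the coordinate space, so none of the \<open>alg_Ak\<close> is void.
\<close>

lemma basis3_axis: "basis3 (axis 1 1 :: real^3) (axis 2 1) (axis 3 1)"
proof -
  have B: "(Basis :: (real^3) set) = {axis 1 1, axis 2 1, axis 3 1}"
    unfolding Basis_vec_def by (auto simp: UNIV_3)
  then show ?thesis
    unfolding basis3_def
    using independent_Basis[where 'a = "real^3"] span_Basis[where 'a = "real^3"]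
    by (simp add: axis_eq_axis)
qed

lemma table_realised:
  fixes p11 p12 p13 p22 p23 p33 :: "real^3"
  defines "e \<equiv> \<lambda>i. axis i 1 :: real^3"
  shows "\<exists>m. comm_algebra m \<and> m (e 1) (e 1) = p11 \<and> m (e 1) (e 2) = p12 \<and> m (e 1) (e 3) = p13 \<and>
           m (e 2) (e 2) = p22 \<and> m (e 2) (e 3) = p23 \<and> m (e 3) (e 3) = p33"
proof (intro exI conjI)
  let ?m = "\<lambda>x y :: real^3. (x$1 * y$1) *\<^sub>R p11 + (x$2 * y$2) *\<^sub>R p22 + (x$3 * y$3) *\<^sub>R p33
     + (x$1 * y$2 + x$2 * y$1) *\<^sub>R p12 + (x$1 * y$3 + x$3 * y$1) *\<^sub>R p13
     + (x$2 * y$3 + x$3 * y$2) *\<^sub>R p23"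
  show "comm_algebra ?m"
    unfolding comm_algebra_def bilinear_def
    by (auto intro!: linearI simp: algebra_simps)
qed (simp_all add: e_def axis_def)

end

theory Submission
  imports Defs
begin

text \<open>
  The product is evaluated only through properties that an isomorphism preserves, and these
  properties already determine the type. Since the multiplication tables are carried along an
  isomorphism (\<open>alg_type_image\<close>), it suffices that one algebra cannot have two types, and for this
  a function \<open>type_index\<close> of the bare product is shown to return \<open>k\<close> on every algebra of type
  $\mathbf{A}k$ (\<open>alg_type_imp_type_index\<close>).

  The first distinction is whether the algebra has a character, a nonzero multiplicative linear
  form. It does exactly for $A_2$, $A_{22}$, $A_5$ and $A_6$. There the character is unique: it is
  the coordinate along $e_3$, with kernel $K$ spanned by $e_1$ and $e_2$. Squares on $K$ vanish
  except for $A_6$. If the character has the value $1$ at $e$, the eigenvalues of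
  multiplication by $e$ on $K$ recover the parameters: $\{\alpha, \beta\}$ for $A_2$ and $A_6$, $\{0\}$ for
  $A_{22}$ and none for $A_5$, where they are not real. For $A_6$ the parameters are not
  interchangeable, and $\alpha$ is singled out as the eigenvalue on $K^2$. Finally, $A_{22}$ and
  $A_2(0,0)$ have the same eigenvalues, but only in the latter does every multiplication
  act on each product as a scalar.

  Among the algebras without a character, $A_1$ has an idempotent, and its parameters are
  recovered from its null elements, those with square zero. If the product of two
  of them is a nonzero idempotent, a factor that is an eigenvector of this product has the
  eigenvalue $\alpha$ or $\beta$, and both occur. For $A_3$ and $A_4$ the null elements span the algebra, for the listed
  algebras $A_7$ and for $A_1$ with $(\alpha,\beta) \neq (0,0)$ they lie in a plane. What remains is a finite list of algebras
  and one-parameter families, each of which has a simple property that fails for the others: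
  nilpotency, solvability, an annihilator, an idempotent, or the way the algebra acts on its
  products.
\<close>

section \<open>Invariants\<close>

definition nonzero_form :: "('a::real_vector \<Rightarrow> real) \<Rightarrow> bool" where
  "nonzero_form \<phi> \<longleftrightarrow> linear \<phi> \<and> (\<exists>v. \<phi> v \<noteq> 0)"

definition character :: "('a::real_vector \<Rightarrow> 'a \<Rightarrow> 'a) \<Rightarrow> ('a \<Rightarrow> real) \<Rightarrow> bool" where
  "character m \<phi> \<longleftrightarrow> nonzero_form \<phi> \<and> (\<forall>v w. \<phi> (m v w) = \<phi> v * \<phi> w)"

definition kernel_null :: "('a::real_vector \<Rightarrow> 'a \<Rightarrow> 'a) \<Rightarrow> bool" where
  "kernel_null m \<longleftrightarrow> (\<forall>\<phi> u. character m \<phi> \<longrightarrow> \<phi> u = 0 \<longrightarrow> m u u = 0)"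

text \<open>
  The real eigenvalues, on the kernel of a character, of the multiplications by elements on which
  the character has the value 1. The choice of such an element is left free because an isomorphism
  need not respect any particular one.
\<close>

definition weights :: "('a::real_vector \<Rightarrow> 'a \<Rightarrow> 'a) \<Rightarrow> real set" where
  "weights m = {c. \<exists>\<phi> e u. character m \<phi> \<and> \<phi> e = 1 \<and> \<phi> u = 0 \<and> u \<noteq> 0 \<and> m e u = c *\<^sub>R u}"

text \<open>
  In $A_6(\alpha,\beta)$ the parameters play different roles, but \<open>weights\<close> only sees the set that
  they form. The squares of the kernel elements are multiples of $e_1$, which belongs to $\alpha$.
\<close>

definition square_weights :: "('a::real_vector \<Rightarrow> 'a \<Rightarrow> 'a) \<Rightarrow> real set" where
  "square_weights m = {c. \<exists>\<phi> e u. character m \<phi> \<and> \<phi> e = 1 \<and> \<phi> u = 0 \<and>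
     m u u \<noteq> 0 \<and> m e (m u u) = c *\<^sub>R m u u}"

text \<open>
  The parameters of $A_1$. Unless both are zero, the two factors are, up to scaling and exchange,
  $e_1$ and $e_2$.
  The idempotency of the product removes the scaling, so that the eigenvalues themselves, and
  not only their ratio, are invariant.
\<close>

definition null_pair_weights :: "('a::real_vector \<Rightarrow> 'a \<Rightarrow> 'a) \<Rightarrow> real set" where
  "null_pair_weights m = {c. \<exists>u v. m u u = 0 \<and> m v v = 0 \<and> m u v \<noteq> 0 \<and>
     m (m u v) (m u v) = m u v \<and> m u (m u v) = c *\<^sub>R u}"

definition null_confined :: "('a::real_vector \<Rightarrow> 'a \<Rightarrow> 'a) \<Rightarrow> bool" where
  "null_confined m \<longleftrightarrow> (\<exists>\<phi>. nonzero_form \<phi> \<and> (\<forall>v. m v v = 0 \<longrightarrow> \<phi> v = 0))"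

definition products_confined :: "('a::real_vector \<Rightarrow> 'a \<Rightarrow> 'a) \<Rightarrow> bool" where
  "products_confined m \<longleftrightarrow> (\<exists>\<phi>. nonzero_form \<phi> \<and> (\<forall>v w. \<phi> (m v w) = 0))"

definition has_idempotent :: "('a::real_vector \<Rightarrow> 'a \<Rightarrow> 'a) \<Rightarrow> bool" where
  "has_idempotent m \<longleftrightarrow> (\<exists>v. v \<noteq> 0 \<and> m v v = v)"

definition has_annihilator :: "('a::real_vector \<Rightarrow> 'a \<Rightarrow> 'a) \<Rightarrow> bool" where
  "has_annihilator m \<longleftrightarrow> (\<exists>v. v \<noteq> 0 \<and> (\<forall>w. m v w = 0))"

definition two_step_nilpotent :: "('a::real_vector \<Rightarrow> 'a \<Rightarrow> 'a) \<Rightarrow> bool" where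
  "two_step_nilpotent m \<longleftrightarrow> (\<forall>u v w. m u (m v w) = 0)"

definition two_step_solvable :: "('a::real_vector \<Rightarrow> 'a \<Rightarrow> 'a) \<Rightarrow> bool" where
  "two_step_solvable m \<longleftrightarrow> (\<forall>t u v w. m (m t u) (m v w) = 0)"

definition homothetic :: "('a::real_vector \<Rightarrow> 'a \<Rightarrow> 'a) \<Rightarrow> bool" where
  "homothetic m \<longleftrightarrow> (\<forall>u v w. \<exists>c. m u (m v w) = c *\<^sub>R m v w)"

definition fixes_products :: "('a::real_vector \<Rightarrow> 'a \<Rightarrow> 'a) \<Rightarrow> bool" where
  "fixes_products m \<longleftrightarrow> (\<exists>u. \<forall>v w. m u (m v w) = m v w)"

section \<open>Coordinates\<close>

text \<open>
  An element is handled through its three coordinates. Equations between elements become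
  equations between reals, and quantifiers over elements need no decomposition along the basis.
\<close>

locale coordinates =
  fixes m :: "'a::real_vector \<Rightarrow> 'a \<Rightarrow> 'a" and e1 e2 e3 :: 'a and X Y Z :: "'a \<Rightarrow> real"
  assumes bilinear: "bilinear m" and commute: "m v w = m w v"
    and lin: "linear X" "linear Y" "linear Z"
    and dual [simp]: "X e1 = 1" "X e2 = 0" "X e3 = 0" "Y e1 = 0" "Y e2 = 1" "Y e3 = 0"
      "Z e1 = 0" "Z e2 = 0" "Z e3 = 1"
    and expand: "v = X v *\<^sub>R e1 + Y v *\<^sub>R e2 + Z v *\<^sub>R e3"
begin

lemmas coordinate_simps [simp] =
  lin(1)[THEN linear_add] lin(1)[THEN linear_cmul] lin(1)[THEN linear_0]
  lin(2)[THEN linear_add] lin(2)[THEN linear_cmul] lin(2)[THEN linear_0]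
  lin(3)[THEN linear_add] lin(3)[THEN linear_cmul] lin(3)[THEN linear_0]

lemma eq_iff: "v = w \<longleftrightarrow> X v = X w \<and> Y v = Y w \<and> Z v = Z w"
  by (metis expand)

lemma mult:
  "m v w = (X v * X w) *\<^sub>R m e1 e1 + (Y v * Y w) *\<^sub>R m e2 e2 + (Z v * Z w) *\<^sub>R m e3 e3
     + (X v * Y w + Y v * X w) *\<^sub>R m e1 e2 + (X v * Z w + Z v * X w) *\<^sub>R m e1 e3
     + (Y v * Z w + Z v * Y w) *\<^sub>R m e2 e3"
proof -
  have c: "m e2 e1 = m e1 e2" "m e3 e1 = m e1 e3" "m e3 e2 = m e2 e3"
    by (simp_all add: commute)
  have "m v w = m (X v *\<^sub>R e1 + Y v *\<^sub>R e2 + Z v *\<^sub>R e3) (X w *\<^sub>R e1 + Y w *\<^sub>R e2 + Z w *\<^sub>R e3)"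
    using expand by metis
  then show ?thesis
    by (simp add: bilinear_ladd[OF bilinear] bilinear_radd[OF bilinear] bilinear_lmul[OF bilinear]
        bilinear_rmul[OF bilinear] c algebra_simps)
qed

lemma form_expand:
  fixes \<phi> :: "'a \<Rightarrow> real"
  assumes "linear \<phi>"
  shows "\<phi> v = X v * \<phi> e1 + Y v * \<phi> e2 + Z v * \<phi> e3"
proof -
  have "\<phi> v = \<phi> (X v *\<^sub>R e1 + Y v *\<^sub>R e2 + Z v *\<^sub>R e3)"
    using expand by metis
  then show ?thesis
    by (simp add: linear_add[OF assms] linear_cmul[OF assms])
qed

lemma nonzero_form_iff:
  "nonzero_form \<phi> \<longleftrightarrow> linear \<phi> \<and> (\<phi> e1 \<noteq> 0 \<or> \<phi> e2 \<noteq> 0 \<or> \<phi> e3 \<noteq> 0)"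
proof (cases "linear \<phi>")
  case True
  have "\<exists>v. \<phi> v \<noteq> 0" if "\<phi> e1 \<noteq> 0 \<or> \<phi> e2 \<noteq> 0 \<or> \<phi> e3 \<noteq> 0"
    using that by blast
  moreover have "\<phi> v = 0" if "\<not> (\<phi> e1 \<noteq> 0 \<or> \<phi> e2 \<noteq> 0 \<or> \<phi> e3 \<noteq> 0)" for v
    using that by (subst form_expand[OF True]) simp
  ultimately show ?thesis
    using True unfolding nonzero_form_def by blast
qed (simp add: nonzero_form_def)

lemma forms: "nonzero_form X" "nonzero_form Y" "nonzero_form Z"
  using lin by (simp_all add: nonzero_form_iff)

end

lemma coordinates_exist:
  assumes "comm_algebra m" and "basis3 e1 e2 e3"
  obtains X Y Z where "coordinates m e1 e2 e3 X Y Z"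
proof -
  let ?B = "{e1, e2, e3}"
  have ind: "independent ?B" and sp: "\<And>v. v \<in> span ?B" and d: "e1 \<noteq> e2" "e1 \<noteq> e3" "e2 \<noteq> e3"
    using assms(2) by (auto simp: basis3_def)
  define R where "R = representation ?B"
  have add: "R (v + w) b = R v b + R w b" and scale: "R (c *\<^sub>R v) b = c * R v b" for v w b c
    unfolding R_def by (simp_all add: real_vector.representation_add[OF ind sp sp]
        real_vector.representation_scale[OF ind sp])
  have R: "R b = (\<lambda>v. if v = b then 1 else 0)" if "b \<in> ?B" for b
    unfolding R_def using real_vector.representation_basis[OF ind that] .
  have ex: "v = R v e1 *\<^sub>R e1 + R v e2 *\<^sub>R e2 + R v e3 *\<^sub>R e3" for v
    using real_vector.sum_representation_eq[OF ind sp, of ?B v] d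
    by (simp add: R_def add.assoc)
  have "coordinates m e1 e2 e3 (\<lambda>v. R v e1) (\<lambda>v. R v e2) (\<lambda>v. R v e3)"
  proof
    show "bilinear m" "m v w = m w v" for v w
      using assms(1) by (simp_all add: comm_algebra_def)
  qed (use d in \<open>simp_all add: add scale R flip: ex\<close>)
  then show ?thesis
    by (rule that)
qed

section \<open>Algebras with a character\<close>

text \<open>
  The tables of $A_2$, $A_{22}$, $A_5$ and $A_6$ at once: an idempotent $e_3$ acts by an arbitrary
  matrix on the plane of $e_1$ and $e_2$, whose only possibly nonzero product is
  $e_2^2 = s e_1$.
\<close>

locale idempotent_extension = coordinates +
  fixes a b c d s :: real
  assumes table: "m e1 e1 = 0" "m e1 e2 = 0" "m e1 e3 = a *\<^sub>R e1 + b *\<^sub>R e2"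
    "m e2 e2 = s *\<^sub>R e1" "m e2 e3 = c *\<^sub>R e1 + d *\<^sub>R e2" "m e3 e3 = e3"
begin

lemma products [simp]:
  "X (m v w) = a * (X v * Z w + Z v * X w) + c * (Y v * Z w + Z v * Y w) + s * (Y v * Y w)"
  "Y (m v w) = b * (X v * Z w + Z v * X w) + d * (Y v * Z w + Z v * Y w)"
  "Z (m v w) = Z v * Z w"
  by (subst mult; simp add: table algebra_simps)+

text \<open>
  A character kills nilpotent elements, hence $e_1$ and then $e_2$, and it sends the
  idempotent $e_3$ to 0 or 1, where 0 would make it vanish.
\<close>

lemma character_iff: "character m \<phi> \<longleftrightarrow> \<phi> = Z"
proof
  assume \<phi>: "character m \<phi>"
  then have l: "linear \<phi>" and p: "\<And>v w. \<phi> (m v w) = \<phi> v * \<phi> w"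
    by (auto simp: character_def nonzero_form_def)
  have 1: "\<phi> e1 = 0"
    using p[of e1 e1] by (simp add: table linear_0[OF l])
  have 2: "\<phi> e2 = 0"
    using p[of e2 e2] 1 by (simp add: table linear_cmul[OF l])
  have 3: "\<phi> e3 = 1"
    using p[of e3 e3] \<phi> 1 2 by (auto simp: table character_def nonzero_form_iff)
  show "\<phi> = Z"
    by (rule ext, subst form_expand[OF l]) (simp add: 1 2 3)
next
  assume "\<phi> = Z"
  then show "character m \<phi>"
    by (simp add: character_def forms)
qed

text \<open>
  With $e = p e_1 + q e_2 + e_3$ and $u = x e_1 + y e_2$, the coefficient $p$ drops out of $e u$,
  and $q$ matters only if $s \neq 0$.
\<close>

lemma weights_iff:
  "l \<in> weights m \<longleftrightarrow> (\<exists>q x y. (x \<noteq> 0 \<or> y \<noteq> 0) \<and> a * x + c * y + s * q * y = l * x \<and> b * x + d * y = l * y)"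
proof
  assume "l \<in> weights m"
  then obtain e u where "Z e = 1" "Z u = 0" "u \<noteq> 0" "m e u = l *\<^sub>R u"
    by (auto simp: weights_def character_iff)
  then show "\<exists>q x y. (x \<noteq> 0 \<or> y \<noteq> 0) \<and> a * x + c * y + s * q * y = l * x \<and> b * x + d * y = l * y"
    by (intro exI[of _ "Y e"] exI[of _ "X u"] exI[of _ "Y u"]) (simp add: eq_iff algebra_simps)
next
  assume "\<exists>q x y. (x \<noteq> 0 \<or> y \<noteq> 0) \<and> a * x + c * y + s * q * y = l * x \<and> b * x + d * y = l * y"
  then obtain q x y where "x \<noteq> 0 \<or> y \<noteq> 0" "a * x + c * y + s * q * y = l * x" "b * x + d * y = l * y"
    by blast
  then show "l \<in> weights m"
    unfolding weights_def mem_Collect_eq character_iff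
    by (intro exI[of _ Z] exI[of _ "q *\<^sub>R e2 + e3"] exI[of _ "x *\<^sub>R e1 + y *\<^sub>R e2"])
      (simp add: eq_iff algebra_simps)
qed

lemma kernel_null_iff: "kernel_null m \<longleftrightarrow> s = 0"
proof
  assume "kernel_null m"
  then have "m e2 e2 = 0"
    by (simp add: kernel_null_def character_iff)
  then show "s = 0"
    by (simp add: eq_iff)
qed (auto simp: kernel_null_def character_iff eq_iff)

lemma square_weights_eq:
  assumes "s \<noteq> 0" and "b = 0"
  shows "square_weights m = {a}"
proof -
  have "a \<in> square_weights m"
    unfolding square_weights_def mem_Collect_eq character_iff
    using assms by (intro exI[of _ Z] exI[of _ e3] exI[of _ e2]) (simp add: eq_iff)
  moreover have "l = a" if "l \<in> square_weights m" for l
    using that assms by (auto simp: square_weights_def character_iff eq_iff)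
  ultimately show ?thesis
    by blast
qed

end

lemma alg_A2_invariants:
  assumes "alg_A2 \<alpha> \<beta> m"
  shows "\<exists>\<phi>. character m \<phi>" "kernel_null m" "weights m = {\<alpha>, \<beta>}"
    and "\<alpha> = 0 \<Longrightarrow> \<beta> = 0 \<Longrightarrow> homothetic m"
proof -
  from assms obtain e1 e2 e3 where c: "comm_algebra m" "basis3 e1 e2 e3"
    and t: "m e1 e1 = 0" "m e1 e2 = 0" "m e1 e3 = \<alpha> *\<^sub>R e1" "m e2 e2 = 0" "m e2 e3 = \<beta> *\<^sub>R e2" "m e3 e3 = e3"
    by (auto simp: alg_A2_def)
  from c obtain X Y Z where "coordinates m e1 e2 e3 X Y Z" by (rule coordinates_exist)
  then interpret coordinates m e1 e2 e3 X Y Z .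
  interpret idempotent_extension m e1 e2 e3 X Y Z \<alpha> 0 0 \<beta> 0
    by unfold_locales (simp_all add: t)
  show "\<exists>\<phi>. character m \<phi>" "kernel_null m"
    by (simp_all add: character_iff kernel_null_iff)
  show "weights m = {\<alpha>, \<beta>}"
    by (auto simp: set_eq_iff weights_iff)
  show "homothetic m" if "\<alpha> = 0" "\<beta> = 0"
    using that by (auto simp: homothetic_def eq_iff)
qed

lemma alg_A22_invariants:
  assumes "alg_A22 m"
  shows "\<exists>\<phi>. character m \<phi>" "kernel_null m" "weights m = {0}" "\<not> homothetic m"
proof -
  from assms obtain e1 e2 e3 where c: "comm_algebra m" "basis3 e1 e2 e3"
    and t: "m e1 e1 = 0" "m e1 e2 = 0" "m e1 e3 = 0" "m e2 e2 = 0" "m e2 e3 = e1" "m e3 e3 = e3"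
    by (auto simp: alg_A22_def)
  from c obtain X Y Z where "coordinates m e1 e2 e3 X Y Z" by (rule coordinates_exist)
  then interpret coordinates m e1 e2 e3 X Y Z .
  interpret idempotent_extension m e1 e2 e3 X Y Z 0 0 1 0 0
    by unfold_locales (simp_all add: t)
  show "\<exists>\<phi>. character m \<phi>" "kernel_null m"
    by (simp_all add: character_iff kernel_null_iff)
  show "weights m = {0}"
    by (auto simp: set_eq_iff weights_iff)
  have "\<nexists>c. m e2 (m e3 e3) = c *\<^sub>R m e3 e3"
    by (simp add: eq_iff)
  then show "\<not> homothetic m"
    unfolding homothetic_def by blast
qed

text \<open>
  The element $e_3$ acts on the plane of $e_1$ and $e_2$ with the eigenvalues $a \pm b i$.
\<close>

lemma alg_A5_invariants:
  assumes "alg_A5 a b m" and "b \<noteq> 0"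
  shows "\<exists>\<phi>. character m \<phi>" "kernel_null m" "weights m = {}"
proof -
  from assms obtain e1 e2 e3 where c: "comm_algebra m" "basis3 e1 e2 e3"
    and t: "m e1 e1 = 0" "m e1 e2 = 0" "m e1 e3 = a *\<^sub>R e1 - b *\<^sub>R e2" "m e2 e2 = 0"
      "m e2 e3 = b *\<^sub>R e1 + a *\<^sub>R e2" "m e3 e3 = e3"
    by (auto simp: alg_A5_def)
  from c obtain X Y Z where "coordinates m e1 e2 e3 X Y Z" by (rule coordinates_exist)
  then interpret coordinates m e1 e2 e3 X Y Z .
  interpret idempotent_extension m e1 e2 e3 X Y Z a "-b" b a 0
    by unfold_locales (simp_all add: t)
  show "\<exists>\<phi>. character m \<phi>" "kernel_null m"
    by (simp_all add: character_iff kernel_null_iff)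
  have False if xy: "x \<noteq> 0 \<or> y \<noteq> 0" and 1: "a * x + b * y = l * x" and 2: "a * y - b * x = l * y" for l x y
  proof -
    \<comment> \<open>The determinant of the two vectors $e_3 u$ and $u$, which vanishes for an eigenvector $u$.\<close>
    have "b * (x\<^sup>2 + y\<^sup>2) = y * (a * x + b * y) - x * (a * y - b * x)"
      by (simp add: algebra_simps power2_eq_square)
    also have "\<dots> = 0"
      by (simp add: 1 2)
    finally show False
      using assms(2) xy by (auto simp: sum_power2_eq_zero_iff)
  qed
  then show "weights m = {}"
    by (auto simp: set_eq_iff weights_iff)
qed

text \<open>
  The element $q e_2 + e_3$ acts on the plane of $e_1$ and $e_2$ by a triangular matrix with
  diagonal entries $\alpha$, $\beta$ and off-diagonal entry $q$. For $q = \beta - \alpha$ the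
  vector $e_1 + e_2$ belongs to $\beta$.
\<close>

lemma alg_A6_invariants:
  assumes "alg_A6 \<alpha> \<beta> m"
  shows "\<exists>\<phi>. character m \<phi>" "\<not> kernel_null m" "weights m = {\<alpha>, \<beta>}" "square_weights m = {\<alpha>}"
proof -
  from assms obtain e1 e2 e3 where c: "comm_algebra m" "basis3 e1 e2 e3"
    and t: "m e1 e1 = 0" "m e1 e2 = 0" "m e1 e3 = \<alpha> *\<^sub>R e1" "m e2 e2 = e1" "m e2 e3 = \<beta> *\<^sub>R e2" "m e3 e3 = e3"
    by (auto simp: alg_A6_def)
  from c obtain X Y Z where "coordinates m e1 e2 e3 X Y Z" by (rule coordinates_exist)
  then interpret coordinates m e1 e2 e3 X Y Z .
  interpret idempotent_extension m e1 e2 e3 X Y Z \<alpha> 0 0 \<beta> 1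
    by unfold_locales (simp_all add: t)
  show "\<exists>\<phi>. character m \<phi>" "\<not> kernel_null m"
    by (simp_all add: character_iff kernel_null_iff)
  have "\<alpha> \<in> weights m"
    unfolding weights_iff by (rule exI[of _ 0], rule exI[of _ 1], rule exI[of _ 0]) simp
  moreover have "\<beta> \<in> weights m"
    unfolding weights_iff by (rule exI[of _ "\<beta> - \<alpha>"], rule exI[of _ 1], rule exI[of _ 1]) simp
  moreover have "c = \<alpha> \<or> c = \<beta>" if "c \<in> weights m" for c
    using that by (auto simp: weights_iff)
  ultimately show "weights m = {\<alpha>, \<beta>}"
    by blast
  show "square_weights m = {\<alpha>}"
    by (simp add: square_weights_eq)
qed

section \<open>Algebras without characters\<close>

text \<open>
  The form of the hypothesis is adapted to the algebras below, in which some of the basis vectors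
  have square zero and are therefore killed at once.
\<close>

lemma (in coordinates) no_character:
  assumes "\<And>\<phi>. \<phi> 0 = 0 \<Longrightarrow> (\<And>v w. \<phi> (m v w) = \<phi> v * \<phi> w) \<Longrightarrow>
    \<phi> e1 = 0 \<and> \<phi> e2 = 0 \<and> \<phi> e3 = (0::real)"
  shows "\<nexists>\<phi>. character m \<phi>"
proof
  assume "\<exists>\<phi>. character m \<phi>"
  then obtain \<phi> where h: "nonzero_form \<phi>" and p: "\<And>v w. \<phi> (m v w) = \<phi> v * \<phi> w"
    by (auto simp: character_def)
  have "\<phi> 0 = 0"
    using h by (simp add: nonzero_form_def linear_0)
  from assms[OF this p] h show False
    by (simp add: nonzero_form_iff)
qed

text \<open>
  A null element satisfies $\alpha x z = \beta y z = 0$ and $2 x y + z^2 = 0$, so $z \neq 0$ is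
  possible only for $\alpha = \beta = 0$. Otherwise $xy = z = 0$, and the null elements are the
  multiples of $e_1$ and $e_2$. In the exceptional case they form a cone that lies in no plane,
  but there the square of the algebra is the line of $e_3$, and \<open>homothetic\<close> serves as a substitute.
\<close>

lemma alg_A1_invariants:
  assumes "alg_A1 \<alpha> \<beta> m"
  shows "\<nexists>\<phi>. character m \<phi>" "has_idempotent m" "null_pair_weights m = {\<alpha>, \<beta>}"
    and "\<alpha> \<noteq> 0 \<or> \<beta> \<noteq> 0 \<Longrightarrow> null_confined m" "\<alpha> = 0 \<Longrightarrow> \<beta> = 0 \<Longrightarrow> homothetic m"
proof -
  from assms obtain e1 e2 e3 where c: "comm_algebra m" "basis3 e1 e2 e3"
    and t: "m e1 e1 = 0" "m e1 e2 = e3" "m e1 e3 = \<alpha> *\<^sub>R e1" "m e2 e2 = 0" "m e2 e3 = \<beta> *\<^sub>R e2" "m e3 e3 = e3"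
    by (auto simp: alg_A1_def)
  from c obtain X Y Z where "coordinates m e1 e2 e3 X Y Z" by (rule coordinates_exist)
  then interpret coordinates m e1 e2 e3 X Y Z .
  have [simp]: "X (m v w) = \<alpha> * (X v * Z w + Z v * X w)" "Y (m v w) = \<beta> * (Y v * Z w + Z v * Y w)"
    "Z (m v w) = X v * Y w + Y v * X w + Z v * Z w" for v w
    by (subst mult, simp add: t algebra_simps)+
  show "\<nexists>\<phi>. character m \<phi>"
  proof (rule no_character)
    fix \<phi> :: "'a \<Rightarrow> real"
    assume "\<phi> 0 = 0" and p: "\<And>v w. \<phi> (m v w) = \<phi> v * \<phi> w"
    then show "\<phi> e1 = 0 \<and> \<phi> e2 = 0 \<and> \<phi> e3 = 0"
      using p[of e1 e1] p[of e2 e2] p[of e1 e2] by (simp add: t)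
  qed
  show "has_idempotent m"
    unfolding has_idempotent_def by (rule exI[of _ e3]) (simp add: eq_iff)
  have Z0: "Z v = 0" if "m v v = 0" "\<alpha> \<noteq> 0 \<or> \<beta> \<noteq> 0" for v
    using that by (auto simp: eq_iff)
  show "null_confined m" if "\<alpha> \<noteq> 0 \<or> \<beta> \<noteq> 0"
    unfolding null_confined_def using forms(3) Z0[OF _ that] by blast
  show "homothetic m" if "\<alpha> = 0" "\<beta> = 0"
    using that by (auto simp: homothetic_def eq_iff)
  have "\<alpha> \<in> null_pair_weights m"
    unfolding null_pair_weights_def mem_Collect_eq by (rule exI[of _ e1], rule exI[of _ e2]) (simp add: eq_iff)
  moreover have "\<beta> \<in> null_pair_weights m"
    unfolding null_pair_weights_def mem_Collect_eq by (rule exI[of _ e2], rule exI[of _ e1]) (simp add: eq_iff)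
  moreover have "l = \<alpha> \<or> l = \<beta>" if "l \<in> null_pair_weights m" for l
  proof -
    from that obtain u v where u: "m u u = 0" and v: "m v v = 0" and uv: "m u v \<noteq> 0" "m (m u v) (m u v) = m u v"
      and l: "m u (m u v) = l *\<^sub>R u"
      by (auto simp: null_pair_weights_def)
    show ?thesis
    proof (cases "\<alpha> = 0 \<and> \<beta> = 0")
      case True
      have "u \<noteq> 0"
        using uv by (auto simp: eq_iff)
      \<comment> \<open>A nonzero null element is no multiple of $e_3$, while all products are, so $l = 0$.\<close>
      then have "X u \<noteq> 0 \<or> Y u \<noteq> 0"
        using u by (auto simp: eq_iff)
      with True l show ?thesis
        by (auto simp: eq_iff)
    next
      case False
      with Z0 u v have z: "Z u = 0" "Z v = 0"
        by auto
      define W where "W = X u * Y v + Y u * X v"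
      have "W = 1"
        using uv z by (auto simp: eq_iff W_def)
      moreover have "\<alpha> * (X u * W) = l * X u" "\<beta> * (Y u * W) = l * Y u"
        using l z by (simp_all add: eq_iff W_def)
      moreover have "X u \<noteq> 0 \<or> Y u \<noteq> 0"
        using \<open>W = 1\<close> by (auto simp: W_def)
      ultimately show ?thesis
        by auto
    qed
  qed
  ultimately show "null_pair_weights m = {\<alpha>, \<beta>}"
    by blast
qed

text \<open>
  The basis consists of null elements. The coordinates of an idempotent satisfy
  $x = 2 \alpha x z$, $y = 2 \beta y z$ and $z = 2 x y$, so if one of them is nonzero, all are. Then
  $2 \alpha z = 1 = 2 \beta z$, which forces $\alpha = \beta$; for $\alpha = \beta = 1$ there is a
  nonzero idempotent.
\<close>

lemma alg_A3_invariants: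
  assumes "alg_A3 \<alpha> \<beta> m"
  shows "\<nexists>\<phi>. character m \<phi>" "\<not> null_confined m"
    and "\<alpha> = 0 \<Longrightarrow> \<beta> = 0 \<Longrightarrow> two_step_nilpotent m" "\<alpha> = 0 \<Longrightarrow> \<beta> = 0 \<Longrightarrow> \<not> has_idempotent m"
    and "\<alpha> = 0 \<Longrightarrow> \<beta> = 0 \<Longrightarrow> two_step_solvable m"
    and "\<alpha> \<noteq> 0 \<or> \<beta> \<noteq> 0 \<Longrightarrow> \<not> homothetic m" "\<alpha> \<noteq> 0 \<or> \<beta> \<noteq> 0 \<Longrightarrow> \<not> two_step_solvable m"
    and "\<alpha> = 0 \<or> \<beta> = 0 \<Longrightarrow> products_confined m" "\<alpha> \<noteq> 0 \<Longrightarrow> \<beta> \<noteq> 0 \<Longrightarrow> \<not> products_confined m"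
    and "\<alpha> = 1 \<Longrightarrow> \<beta> = 1 \<Longrightarrow> has_idempotent m" "\<alpha> \<noteq> \<beta> \<Longrightarrow> \<not> has_idempotent m"
proof -
  from assms obtain e1 e2 e3 where c: "comm_algebra m" "basis3 e1 e2 e3"
    and t: "m e1 e1 = 0" "m e1 e2 = e3" "m e1 e3 = \<alpha> *\<^sub>R e1" "m e2 e2 = 0" "m e2 e3 = \<beta> *\<^sub>R e2" "m e3 e3 = 0"
    by (auto simp: alg_A3_def)
  from c obtain X Y Z where "coordinates m e1 e2 e3 X Y Z" by (rule coordinates_exist)
  then interpret coordinates m e1 e2 e3 X Y Z .
  have [simp]: "X (m v w) = \<alpha> * (X v * Z w + Z v * X w)" "Y (m v w) = \<beta> * (Y v * Z w + Z v * Y w)"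
    "Z (m v w) = X v * Y w + Y v * X w" for v w
    by (subst mult, simp add: t algebra_simps)+
  show "\<nexists>\<phi>. character m \<phi>"
  proof (rule no_character)
    fix \<phi> :: "'a \<Rightarrow> real"
    assume "\<phi> 0 = 0" and p: "\<And>v w. \<phi> (m v w) = \<phi> v * \<phi> w"
    then show "\<phi> e1 = 0 \<and> \<phi> e2 = 0 \<and> \<phi> e3 = 0"
      using p[of e1 e1] p[of e2 e2] p[of e3 e3] by (simp add: t)
  qed
  show "\<not> null_confined m"
    using t by (auto simp: null_confined_def nonzero_form_iff)
  show "two_step_nilpotent m" "two_step_solvable m" if "\<alpha> = 0" "\<beta> = 0"
    using that by (auto simp: two_step_nilpotent_def two_step_solvable_def eq_iff)
  show "\<not> has_idempotent m" if "\<alpha> = 0" "\<beta> = 0"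
    using that by (auto simp: has_idempotent_def eq_iff)
  show "\<not> has_idempotent m" if ne: "\<alpha> \<noteq> \<beta>"
  proof
    assume "has_idempotent m"
    then obtain v where "v \<noteq> 0" "m v v = v"
      by (auto simp: has_idempotent_def)
    then have n: "X v \<noteq> 0 \<or> Y v \<noteq> 0 \<or> Z v \<noteq> 0"
      and x: "2 * \<alpha> * Z v * X v = X v" and y: "2 * \<beta> * Z v * Y v = Y v" and z: "2 * X v * Y v = Z v"
      by (auto simp: eq_iff)
    from n x y z have nz: "X v \<noteq> 0" "Y v \<noteq> 0" "Z v \<noteq> 0"
      by auto
    then have "2 * \<alpha> * Z v = 1" "2 * \<beta> * Z v = 1"
      using x y by auto
    then have "(\<alpha> - \<beta>) * Z v = 0"
      by algebra
    with nz ne show False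
      by simp
  qed
  show "\<not> homothetic m" if "\<alpha> \<noteq> 0 \<or> \<beta> \<noteq> 0"
  proof
    assume "homothetic m"
    then obtain k l where "m e1 (m e1 e2) = k *\<^sub>R m e1 e2" "m e2 (m e1 e2) = l *\<^sub>R m e1 e2"
      unfolding homothetic_def by meson
    with that show False
      by (auto simp: eq_iff)
  qed
  show "\<not> two_step_solvable m" if "\<alpha> \<noteq> 0 \<or> \<beta> \<noteq> 0"
  proof
    assume "two_step_solvable m"
    then have "m (m e1 e2) (m e1 e3) = 0" "m (m e1 e2) (m e2 e3) = 0"
      by (simp_all add: two_step_solvable_def)
    with that show False
      by (auto simp: eq_iff)
  qed
  show "products_confined m" if "\<alpha> = 0 \<or> \<beta> = 0"
    using that
  proof
    assume "\<alpha> = 0"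
    then show ?thesis
      unfolding products_confined_def by (intro exI[of _ X]) (simp add: forms)
  next
    assume "\<beta> = 0"
    then show ?thesis
      unfolding products_confined_def by (intro exI[of _ Y]) (simp add: forms)
  qed
  show "\<not> products_confined m" if "\<alpha> \<noteq> 0" "\<beta> \<noteq> 0"
  proof
    assume "products_confined m"
    then obtain \<phi> where h: "nonzero_form \<phi>" and p: "\<And>v w. \<phi> (m v w) = 0"
      by (auto simp: products_confined_def)
    have l: "linear \<phi>"
      using h by (simp add: nonzero_form_def)
    show False
      using h that p[of e1 e3] p[of e2 e3] p[of e1 e2] by (simp add: t nonzero_form_iff linear_cmul[OF l])
  qed
  show "has_idempotent m" if "\<alpha> = 1" "\<beta> = 1"
    unfolding has_idempotent_def
    by (rule exI[of _ "(1/2) *\<^sub>R e1 + (1/2) *\<^sub>R e2 + (1/2) *\<^sub>R e3"]) (simp add: eq_iff that)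
qed

text \<open>
  The plane of $e_1$ and $e_2$ contains all products and has zero multiplication, so everything is
  decided by the action of $e_3$ on it, with eigenvalues $\alpha$ and $\beta$.
\<close>

lemma alg_A4_invariants:
  assumes "alg_A4 \<alpha> \<beta> m"
  shows "\<nexists>\<phi>. character m \<phi>" "\<not> null_confined m" "\<not> has_idempotent m" "two_step_solvable m"
    and "\<alpha> \<noteq> 0 \<or> \<beta> \<noteq> 0 \<Longrightarrow> \<not> two_step_nilpotent m"
    and "\<alpha> = 0 \<Longrightarrow> has_annihilator m" "\<alpha> \<noteq> 0 \<Longrightarrow> \<beta> \<noteq> 0 \<Longrightarrow> \<not> has_annihilator m"
    and "\<alpha> = \<beta> \<Longrightarrow> homothetic m" "\<alpha> \<noteq> 0 \<Longrightarrow> \<beta> \<noteq> 0 \<Longrightarrow> \<alpha> \<noteq> \<beta> \<Longrightarrow> \<not> homothetic m"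
proof -
  from assms obtain e1 e2 e3 where c: "comm_algebra m" "basis3 e1 e2 e3"
    and t: "m e1 e1 = 0" "m e1 e2 = 0" "m e1 e3 = \<alpha> *\<^sub>R e1" "m e2 e2 = 0" "m e2 e3 = \<beta> *\<^sub>R e2" "m e3 e3 = 0"
    by (auto simp: alg_A4_def)
  from c obtain X Y Z where "coordinates m e1 e2 e3 X Y Z" by (rule coordinates_exist)
  then interpret coordinates m e1 e2 e3 X Y Z .
  have [simp]: "X (m v w) = \<alpha> * (X v * Z w + Z v * X w)" "Y (m v w) = \<beta> * (Y v * Z w + Z v * Y w)"
    "Z (m v w) = 0" for v w
    by (subst mult, simp add: t algebra_simps)+
  show "\<nexists>\<phi>. character m \<phi>"
  proof (rule no_character)
    fix \<phi> :: "'a \<Rightarrow> real"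
    assume "\<phi> 0 = 0" and p: "\<And>v w. \<phi> (m v w) = \<phi> v * \<phi> w"
    then show "\<phi> e1 = 0 \<and> \<phi> e2 = 0 \<and> \<phi> e3 = 0"
      using p[of e1 e1] p[of e2 e2] p[of e3 e3] by (simp add: t)
  qed
  show "\<not> null_confined m"
    using t by (auto simp: null_confined_def nonzero_form_iff)
  show "\<not> has_idempotent m"
    by (auto simp: has_idempotent_def eq_iff)
  show "two_step_solvable m"
    by (auto simp: two_step_solvable_def eq_iff)
  show "\<not> two_step_nilpotent m" if "\<alpha> \<noteq> 0 \<or> \<beta> \<noteq> 0"
  proof
    assume "two_step_nilpotent m"
    then have "m e3 (m e3 e1) = 0" "m e3 (m e3 e2) = 0"
      by (simp_all add: two_step_nilpotent_def)
    with that show False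
      by (auto simp: eq_iff)
  qed
  show "has_annihilator m" if "\<alpha> = 0"
    unfolding has_annihilator_def by (rule exI[of _ e1]) (simp add: eq_iff that)
  show "\<not> has_annihilator m" if "\<alpha> \<noteq> 0" "\<beta> \<noteq> 0"
  proof
    assume "has_annihilator m"
    then obtain v where "v \<noteq> 0" "m v e1 = 0" "m v e3 = 0"
      by (auto simp: has_annihilator_def)
    with that show False
      by (simp add: eq_iff)
  qed
  show "homothetic m" if "\<alpha> = \<beta>"
    unfolding homothetic_def
  proof (intro allI exI)
    fix u v w
    show "m u (m v w) = (\<alpha> * Z u) *\<^sub>R m v w"
      by (simp add: eq_iff that)
  qed
  show "\<not> homothetic m" if "\<alpha> \<noteq> 0" "\<beta> \<noteq> 0" "\<alpha> \<noteq> \<beta>"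
  proof
    assume "homothetic m"
    \<comment> \<open>The product $e_3(e_1 + e_2)$ has a component in each of the two eigenspaces.\<close>
    then obtain k where "m e3 (m e3 (e1 + e2)) = k *\<^sub>R m e3 (e1 + e2)"
      unfolding homothetic_def by meson
    with that show False
      by (simp add: eq_iff)
  qed
qed

text \<open>
  A null element satisfies $\alpha x z = 0$ and $x^2 + 2 \beta y z = 0$. If $\alpha \neq 0$ or
  $\beta = 0$ this forces $x = 0$. For $\alpha \neq 0$ the products span the plane of $e_1$
  and $e_2$, and an element that fixes $\alpha e_1 = e_1 e_3$ and $e_2 = e_1^2$ has a
  third coordinate $z$ with $\alpha z = 1 = \beta z$.
\<close>

lemma alg_A7_invariants:
  assumes "alg_A7 \<alpha> \<beta> m"
  shows "\<nexists>\<phi>. character m \<phi>" "\<not> has_idempotent m"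
    and "\<alpha> \<noteq> 0 \<or> \<beta> = 0 \<Longrightarrow> null_confined m"
    and "\<alpha> = 0 \<Longrightarrow> \<beta> = 0 \<Longrightarrow> two_step_nilpotent m" "\<alpha> \<noteq> 0 \<Longrightarrow> \<not> two_step_nilpotent m"
    and "\<beta> = 0 \<Longrightarrow> has_annihilator m" "\<alpha> \<noteq> 0 \<Longrightarrow> \<beta> \<noteq> 0 \<Longrightarrow> \<not> has_annihilator m"
    and "\<alpha> = 1 \<Longrightarrow> \<beta> = 1 \<Longrightarrow> fixes_products m" "\<alpha> \<noteq> 0 \<Longrightarrow> \<alpha> \<noteq> \<beta> \<Longrightarrow> \<not> fixes_products m"
proof -
  from assms obtain e1 e2 e3 where c: "comm_algebra m" "basis3 e1 e2 e3"
    and t: "m e1 e1 = e2" "m e1 e2 = 0" "m e1 e3 = \<alpha> *\<^sub>R e1" "m e2 e2 = 0" "m e2 e3 = \<beta> *\<^sub>R e2" "m e3 e3 = 0"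
    by (auto simp: alg_A7_def)
  from c obtain X Y Z where "coordinates m e1 e2 e3 X Y Z" by (rule coordinates_exist)
  then interpret coordinates m e1 e2 e3 X Y Z .
  have [simp]: "X (m v w) = \<alpha> * (X v * Z w + Z v * X w)"
    "Y (m v w) = X v * X w + \<beta> * (Y v * Z w + Z v * Y w)" "Z (m v w) = 0" for v w
    by (subst mult, simp add: t algebra_simps)+
  show "\<nexists>\<phi>. character m \<phi>"
  proof (rule no_character)
    fix \<phi> :: "'a \<Rightarrow> real"
    assume "\<phi> 0 = 0" and p: "\<And>v w. \<phi> (m v w) = \<phi> v * \<phi> w"
    then show "\<phi> e1 = 0 \<and> \<phi> e2 = 0 \<and> \<phi> e3 = 0"
      using p[of e1 e1] p[of e2 e2] p[of e3 e3] by (simp add: t)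
  qed
  show "\<not> has_idempotent m"
    by (auto simp: has_idempotent_def eq_iff)
  have X0: "X v = 0" if "m v v = 0" "\<alpha> \<noteq> 0 \<or> \<beta> = 0" for v
    using that by (auto simp: eq_iff)
  show "null_confined m" if "\<alpha> \<noteq> 0 \<or> \<beta> = 0"
    unfolding null_confined_def using forms(1) X0[OF _ that] by blast
  show "two_step_nilpotent m" if "\<alpha> = 0" "\<beta> = 0"
    using that by (auto simp: two_step_nilpotent_def eq_iff)
  show "\<not> two_step_nilpotent m" if "\<alpha> \<noteq> 0"
  proof
    assume "two_step_nilpotent m"
    then have "m e3 (m e3 e1) = 0"
      by (simp add: two_step_nilpotent_def)
    with that show False
      by (simp add: eq_iff)
  qed
  show "has_annihilator m" if "\<beta> = 0"
    unfolding has_annihilator_def by (rule exI[of _ e2]) (simp add: eq_iff that)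
  show "\<not> has_annihilator m" if "\<alpha> \<noteq> 0" "\<beta> \<noteq> 0"
  proof
    assume "has_annihilator m"
    then obtain v where "v \<noteq> 0" "m v e1 = 0" "m v e3 = 0"
      by (auto simp: has_annihilator_def)
    with that show False
      by (simp add: eq_iff)
  qed
  show "fixes_products m" if "\<alpha> = 1" "\<beta> = 1"
    unfolding fixes_products_def by (rule exI[of _ e3]) (simp add: eq_iff that)
  show "\<not> fixes_products m" if "\<alpha> \<noteq> 0" "\<alpha> \<noteq> \<beta>"
  proof
    assume "fixes_products m"
    then obtain u where "m u (m e1 e3) = m e1 e3" "m u (m e1 e1) = m e1 e1"
      by (auto simp: fixes_products_def)
    then have "\<alpha> * (\<alpha> * Z u) = \<alpha>" "\<beta> * Z u = 1"
      by (simp_all add: eq_iff mult.commute)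
    then have "\<alpha> * Z u = 1" "\<beta> * Z u = 1"
      using that by simp_all
    then have "(\<alpha> - \<beta>) * Z u = 0" "Z u \<noteq> 0"
      by (auto simp: algebra_simps)
    with that show False
      by simp
  qed
qed

section \<open>The type as an invariant\<close>

text \<open>
  In $A_1$ and in $A_2$ the parameters $\alpha$ and $\beta$ may be exchanged together with $e_1$ and
  $e_2$, so the number of the type within the family is a function of the set
  $\{\alpha, \beta\}$.
\<close>

definition pair_index :: "real set \<Rightarrow> nat" where
  "pair_index S =
    (if S = {0} then 1 else if S = {0, 1/2} then 2 else if S = {1/2} then 3
     else if 0 \<in> S then 4 else if 1/2 \<in> S then 5 else if is_singleton S then 6 else 7)"

text \<open>
  The type of $A_6(\alpha,\beta)$ as a function of $S = \{\alpha\}$ and $T = \{\alpha, \beta\}$, which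
  together determine the ordered pair.
\<close>

definition ordered_pair_index :: "real set \<Rightarrow> real set \<Rightarrow> nat" where
  "ordered_pair_index S T =
    (if S = {0} then if T = {0} then 25 else if T = {0, 1/2} then 26 else 24
     else if S = {1/2} then if T = {1/2} then 30 else 31
     else if 1/2 \<in> T then 29 else if S = T then 28 else 27)"

text \<open>
  The condition \<open>null_confined m \<or> homothetic m\<close> separates $A_1$ from $A_3(1,1)$, the only other
  type of algebra that has an idempotent but no character.
\<close>

definition type_index :: "('a::real_vector \<Rightarrow> 'a \<Rightarrow> 'a) \<Rightarrow> nat" where
  "type_index m =
    (if \<exists>\<phi>. character m \<phi> then
       if \<not> kernel_null m then ordered_pair_index (square_weights m) (weights m)
       else if weights m = {} then 23
       else if weights m = {0} \<and> \<not> homothetic m then 22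
       else 7 + pair_index (weights m)
     else if has_idempotent m \<and> (null_confined m \<or> homothetic m) then pair_index (null_pair_weights m)
     else if null_confined m then
       if two_step_nilpotent m then 32 else if has_annihilator m then 35
       else if fixes_products m then 34 else 33
     else if two_step_solvable m then
       if two_step_nilpotent m then 15 else if has_annihilator m then 19
       else if homothetic m then 20 else 21
     else if products_confined m then 16 else if has_idempotent m then 17 else 18)"

lemma type_index_alg_A1: "alg_A1 \<alpha> \<beta> m \<Longrightarrow> type_index m = pair_index {\<alpha>, \<beta>}"
  using alg_A1_invariants[of \<alpha> \<beta> m] by (auto simp: type_index_def)

lemma type_index_alg_A2: "alg_A2 \<alpha> \<beta> m \<Longrightarrow> type_index m = 7 + pair_index {\<alpha>, \<beta>}"
  using alg_A2_invariants[of \<alpha> \<beta> m] by (auto simp: type_index_def)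

lemma type_index_alg_A6: "alg_A6 \<alpha> \<beta> m \<Longrightarrow> type_index m = ordered_pair_index {\<alpha>} {\<alpha>, \<beta>}"
  using alg_A6_invariants[of \<alpha> \<beta> m] by (auto simp: type_index_def)

lemma alg_type_imp_type_index: "alg_type i m \<Longrightarrow> i = type_index m"
proof (induction rule: alg_type.induct)
  case (A15 m)
  then show ?case using alg_A3_invariants[OF A15] by (simp add: type_index_def)
next
  case (A16 m)
  then show ?case using alg_A3_invariants[OF A16] by (simp add: type_index_def)
next
  case (A17 m)
  then show ?case using alg_A3_invariants[OF A17] by (simp add: type_index_def)
next
  case (A18 \<beta> m)
  then show ?case using alg_A3_invariants[OF A18(2)] by (simp add: type_index_def)
next
  case (A19 m)
  then show ?case using alg_A4_invariants[OF A19] by (simp add: type_index_def)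
next
  case (A20 m)
  then show ?case using alg_A4_invariants[OF A20] by (simp add: type_index_def)
next
  case (A21 \<beta> m)
  then show ?case using alg_A4_invariants[OF A21(2)] by (simp add: type_index_def)
next
  case (A22 m)
  then show ?case using alg_A22_invariants[OF A22] by (simp add: type_index_def)
next
  case (A23 b a m)
  then show ?case using alg_A5_invariants[OF A23(2)] by (simp add: type_index_def)
next
  case (A32 m)
  then show ?case using alg_A7_invariants[OF A32] by (simp add: type_index_def)
next
  case (A33 \<beta> m)
  then show ?case using alg_A7_invariants[OF A33(2)] by (simp add: type_index_def)
next
  case (A34 m)
  then show ?case using alg_A7_invariants[OF A34] by (simp add: type_index_def)
next
  case (A35 m)
  then show ?case using alg_A7_invariants[OF A35] by (simp add: type_index_def)
qed (auto simp: type_index_alg_A1 type_index_alg_A2 type_index_alg_A6 pair_index_def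
      ordered_pair_index_def is_singleton_def doubleton_eq_iff)

section \<open>Transport along isomorphisms\<close>

locale algebra_isomorphism =
  fixes f :: "'a::real_vector \<Rightarrow> 'b::real_vector" and m n
  assumes lin: "linear f" and bij: "bij f" and hom: "f (m x y) = n (f x) (f y)"
begin

lemma comm_algebra_image:
  assumes "comm_algebra m"
  shows "comm_algebra n"
proof -
  have bil: "bilinear m" and com: "\<And>x y. m x y = m y x"
    using assms by (auto simp: comm_algebra_def)
  have surj: "\<exists>x. y = f x" for y
    using bij by (metis bij_pointE)
  have com': "n y z = n z y" for y z
    using surj[of y] surj[of z] com by (auto simp flip: hom)
  have add: "n y (z + z') = n y z + n y z'" for y z z'
  proof -
    obtain a b c where "y = f a" "z = f b" "z' = f c"
      using surj by meson
    then show ?thesis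
      by (simp add: bilinear_radd[OF bil] flip: hom linear_add[OF lin])
  qed
  have scale: "n y (c *\<^sub>R z) = c *\<^sub>R n y z" for y z c
  proof -
    obtain a b where "y = f a" "z = f b"
      using surj by meson
    then show ?thesis
      by (simp add: bilinear_rmul[OF bil] flip: hom linear_cmul[OF lin])
  qed
  have "linear (n y)" for y
    by (rule linearI) (simp_all add: add scale)
  moreover have "(\<lambda>y. n y z) = n z" for z
    using com' by blast
  ultimately show ?thesis
    unfolding comm_algebra_def bilinear_def using com' by simp
qed

lemma basis3_image:
  assumes "basis3 e1 e2 e3"
  shows "basis3 (f e1) (f e2) (f e3)"
proof -
  have ind: "independent {e1, e2, e3}" and sp: "span {e1, e2, e3} = UNIV" and d: "distinct [e1, e2, e3]"
    using assms by (auto simp: basis3_def)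
  have inj: "inj f" and surj: "surj f"
    using bij by (auto simp: bij_def)
  have "independent (f ` {e1, e2, e3})"
    by (rule linear_independent_injective_image[OF lin ind]) (simp add: sp inj)
  moreover have "span (f ` {e1, e2, e3}) = UNIV"
    using linear_span_image[OF lin, of "{e1, e2, e3}"] sp surj by simp
  moreover have "distinct [f e1, f e2, f e3]"
    using d inj by (auto dest: injD)
  ultimately show ?thesis
    by (simp add: basis3_def)
qed

lemmas image_simps = hom[symmetric] linear_0[OF lin] linear_cmul[OF lin]
  linear_add[OF lin] linear_diff[OF lin]

lemma alg_A1_image: "alg_A1 \<alpha> \<beta> m \<Longrightarrow> alg_A1 \<alpha> \<beta> n"
  unfolding alg_A1_def
  by (elim conjE exE, intro conjI, erule comm_algebra_image, intro exI conjI, erule basis3_image)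
    (simp_all add: image_simps)

lemma alg_A2_image: "alg_A2 \<alpha> \<beta> m \<Longrightarrow> alg_A2 \<alpha> \<beta> n"
  unfolding alg_A2_def
  by (elim conjE exE, intro conjI, erule comm_algebra_image, intro exI conjI, erule basis3_image)
    (simp_all add: image_simps)

lemma alg_A3_image: "alg_A3 \<alpha> \<beta> m \<Longrightarrow> alg_A3 \<alpha> \<beta> n"
  unfolding alg_A3_def
  by (elim conjE exE, intro conjI, erule comm_algebra_image, intro exI conjI, erule basis3_image)
    (simp_all add: image_simps)

lemma alg_A4_image: "alg_A4 \<alpha> \<beta> m \<Longrightarrow> alg_A4 \<alpha> \<beta> n"
  unfolding alg_A4_def
  by (elim conjE exE, intro conjI, erule comm_algebra_image, intro exI conjI, erule basis3_image)
    (simp_all add: image_simps)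

lemma alg_A22_image: "alg_A22 m \<Longrightarrow> alg_A22 n"
  unfolding alg_A22_def
  by (elim conjE exE, intro conjI, erule comm_algebra_image, intro exI conjI, erule basis3_image)
    (simp_all add: image_simps)

lemma alg_A5_image: "alg_A5 a b m \<Longrightarrow> alg_A5 a b n"
  unfolding alg_A5_def
  by (elim conjE exE, intro conjI, erule comm_algebra_image, intro exI conjI, erule basis3_image)
    (simp_all add: image_simps)

lemma alg_A6_image: "alg_A6 \<alpha> \<beta> m \<Longrightarrow> alg_A6 \<alpha> \<beta> n"
  unfolding alg_A6_def
  by (elim conjE exE, intro conjI, erule comm_algebra_image, intro exI conjI, erule basis3_image)
    (simp_all add: image_simps)

lemma alg_A7_image: "alg_A7 \<alpha> \<beta> m \<Longrightarrow> alg_A7 \<alpha> \<beta> n"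
  unfolding alg_A7_def
  by (elim conjE exE, intro conjI, erule comm_algebra_image, intro exI conjI, erule basis3_image)
    (simp_all add: image_simps)

lemma alg_type_image: "alg_type i m \<Longrightarrow> alg_type i n"
  by (erule alg_type.cases; hypsubst; blast intro: alg_type.intros alg_A1_image alg_A2_image
      alg_A3_image alg_A4_image alg_A22_image alg_A5_image alg_A6_image alg_A7_image)

end

theorem theorem2p2:
  fixes m :: "'a::real_vector \<Rightarrow> 'a \<Rightarrow> 'a"
    and n :: "'b::real_vector \<Rightarrow> 'b \<Rightarrow> 'b"
    and i j :: nat
  assumes "i \<in> {1..35}" and "j \<in> {1..35}" and "i \<noteq> j"
    and "alg_type i m" and "alg_type j n"
  shows "\<not> alg_isomorphic m n"
proof
  assume "alg_isomorphic m n"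
  then obtain f where "algebra_isomorphism f m n"
    by (auto simp: alg_isomorphic_def algebra_isomorphism_def)
  then have "alg_type i n"
    using assms(4) by (rule algebra_isomorphism.alg_type_image)
  then have "i = j"
    using assms(5) by (metis alg_type_imp_type_index)
  with assms(3) show False
    by contradiction
qed

end
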